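(* Let $f\colon \mathbb{R} \to \mathbb{R}$ be a Lebesgue measurable function that takes only finitely many values in $\mathbb{R}$. Then there exist $x \in \mathbb{R}$ and $y>0$ such that \[ \int_x^{x+y} f\, d\lambda = \int_{x+y}^{x+2y} f\, d\lambda . \]
   Context: $\lambda$ denotes the Lebesgue measure on $\mathbb{R}$, and $\int_a^b f\, d\lambda$ (for $a<b$) is the Lebesgue integral of $f$ over the interval $[a,b]$. *)

theory Defs
  imports "HOL-Analysis.Analysis"
begin

end

theory Submission
  imports Defs
begin

text \<open>
  Let \<open>F\<close> be an indefinite integral of \<open>f\<close>. If the claim fails, then by connectedness of the
  half plane \<open>y > 0\<close> the second difference \<open>F (x + 2 * y) - 2 * F (x + y) + F x\<close> has a constant
  sign, positive say (otherwise pass to \<open>-f\<close>). Adding up equal steps, the difference quotients of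
  \<open>F\<close> increase, so by Lebesgue differentiation \<open>f\<close> is nondecreasing off a null set. Taking only
  finitely many values, \<open>f\<close> agrees at two points \<open>u < v\<close> off the null set and is therefore almost
  everywhere constant between them, where the second difference vanishes.
\<close>

text \<open>The intermediate value theorem applies to the second difference of a primitive along the
  segment from \<open>(x0, y0)\<close> to \<open>(x1, y1)\<close>, which stays in the half plane
  \<open>y > 0\<close> by convexity.\<close>

lemma integral_second_difference_vanishes:
  fixes f :: "real \<Rightarrow> real"
  assumes int: "\<And>a b. f integrable_on {a..b}"
    and "y0 > 0" "y1 > 0"
    and neg: "integral {x0 + y0..x0 + 2 * y0} f \<le> integral {x0..x0 + y0} f"
    and pos: "integral {x1..x1 + y1} f \<le> integral {x1 + y1..x1 + 2 * y1} f"
  shows "\<exists>x y. y > 0 \<and> integral {x..x + y} f = integral {x + y..x + 2 * y} f"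
proof -
  \<comment> \<open>All intervals met along the segment lie in \<open>{m..M}\<close>, so the one
    primitive \<open>F\<close> based at \<open>m\<close> serves for every \<open>t\<close>.\<close>
  define m where "m = min x0 x1"
  define M where "M = max (x0 + 2 * y0) (x1 + 2 * y1)"
  define F where "F = (\<lambda>t. integral {m..t} f)"
  define X where "X = (\<lambda>t. (1 - t) * x0 + t * x1)"
  define Y where "Y = (\<lambda>t. (1 - t) * y0 + t * y1)"
  define g where "g = (\<lambda>t. F (X t + 2 * Y t) - 2 * F (X t + Y t) + F (X t))"
  have F: "integral {a..b} f = F b - F a" if "m \<le> a" "a \<le> b" for a b
    unfolding F_def using Henstock_Kurzweil_Integration.integral_combine[OF that int] by simp
  have Y: "Y t > 0" if "t \<in> {0..1}" for t
    using that \<open>y0 > 0\<close> \<open>y1 > 0\<close> unfolding Y_def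
    by (cases "t = 0") (auto intro!: add_nonneg_pos)
  have mX: "m \<le> X t" if "t \<in> {0..1}" for t
    using that convex_bound_le[of "- x0" "- m" "- x1" "1 - t" t]
    by (auto simp: X_def m_def)
  have XM: "X t + 2 * Y t \<le> M" if "t \<in> {0..1}" for t
    using that convex_bound_le[of "x0 + 2 * y0" M "x1 + 2 * y1" "1 - t" t]
    by (auto simp: X_def Y_def M_def algebra_simps)
  have g: "g t = integral {X t + Y t..X t + 2 * Y t} f - integral {X t..X t + Y t} f"
    if "t \<in> {0..1}" for t
    using F[of "X t" "X t + Y t"] F[of "X t + Y t" "X t + 2 * Y t"] mX[OF that] Y[OF that]
    by (simp add: g_def)
  have contF: "continuous_on {m..M} F"
    unfolding F_def by (rule indefinite_integral_continuous_1[OF int])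
  have XY: "continuous_on {0..1} X" "continuous_on {0..1} Y"
    unfolding X_def Y_def by (intro continuous_intros)+
  have "continuous_on {0..1} g"
    unfolding g_def
  proof (intro continuous_intros continuous_on_compose2[OF contF] XY)
  qed (use mX XM Y in \<open>fastforce dest: order_less_imp_le\<close>)+
  moreover have "g 0 \<le> 0" "0 \<le> g 1"
    using neg pos by (simp_all add: g X_def Y_def)
  ultimately obtain t where "t \<in> {0..1}" "g t = 0"
    using IVT'[of g 0 0 1] by auto
  then show ?thesis
    using g Y by (metis eq_iff_diff_eq_0)
qed

lemma second_difference_pos_imp_AE_mono:
  fixes f :: "real \<Rightarrow> real"
  assumes int: "\<And>a b. f integrable_on {a..b}"
    and less: "\<And>x y. y > 0 \<Longrightarrow> integral {x..x + y} f < integral {x + y..x + 2 * y} f"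
  obtains N where "negligible N" "\<And>u v. u \<notin> N \<Longrightarrow> v \<notin> N \<Longrightarrow> u \<le> v \<Longrightarrow> f u \<le> f v"
proof -
  \<comment> \<open>Lebesgue differentiation with right-hand averages: \<open>N\<close> is the
    exceptional null set.\<close>
  obtain N where N: "negligible N" and
    lim: "\<And>x e. \<lbrakk>x \<notin> N; 0 < e\<rbrakk> \<Longrightarrow>
      \<exists>d>0. \<forall>h. 0 < h \<and> h < d \<longrightarrow> \<bar>integral {x..x + h} f / h - f x\<bar> < e"
    using integrable_ccontinuous_explicit[of f] int
    by (auto simp: cbox_interval divide_inverse_commute)
  have "f u \<le> f v" if "u \<notin> N" "v \<notin> N" "u < v" for u v
  proof (rule ccontr)
    assume "\<not> f u \<le> f v"
    \<comment> \<open>Half the gap, so that the \<open>e\<close>-neighbourhoods of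
      \<open>f u\<close> and \<open>f v\<close> are disjoint.\<close>
    define e where "e = (f u - f v) / 2"
    have "e > 0" using \<open>\<not> f u \<le> f v\<close> by (simp add: e_def)
    obtain d1 where d1: "d1 > 0"
      "\<And>h. 0 < h \<Longrightarrow> h < d1 \<Longrightarrow> \<bar>integral {u..u + h} f / h - f u\<bar> < e"
      using lim[OF \<open>u \<notin> N\<close> \<open>e > 0\<close>] by auto
    obtain d2 where d2: "d2 > 0"
      "\<And>h. 0 < h \<Longrightarrow> h < d2 \<Longrightarrow> \<bar>integral {v..v + h} f / h - f v\<bar> < e"
      using lim[OF \<open>v \<notin> N\<close> \<open>e > 0\<close>] by auto
    obtain n where n: "n \<noteq> 0" "inverse (real n) < min d1 d2 / (v - u)"
      using real_arch_inverse[of "min d1 d2 / (v - u)"] d1 d2 \<open>u < v\<close> by auto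
    define h where "h = (v - u) / n"
    have h: "0 < h" "h < d1" "h < d2"
      using n \<open>u < v\<close> by (auto simp: h_def field_simps)
    \<comment> \<open>Integrals over consecutive steps of length \<open>h\<close>. Since
      \<open>n\<close> steps lead exactly from \<open>u\<close> to \<open>v\<close>, the term
      \<open>a n\<close> belongs to the step that starts at \<open>v\<close>.\<close>
    define a where "a = (\<lambda>k. integral {u + real k * h..u + real k * h + h} f)"
    have "a k \<le> a (Suc k)" for k
      using less[OF h(1), of "u + real k * h"] by (simp add: a_def algebra_simps)
    then have "a 0 \<le> a n"
      by (rule lift_Suc_mono_le) simp
    moreover have "u + real n * h = v"
      using n by (simp add: h_def)
    ultimately have "integral {u..u + h} f / h \<le> integral {v..v + h} f / h"
      using h by (simp add: a_def divide_right_mono)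
    moreover have "q < p" if "\<bar>p - f u\<bar> < e" "\<bar>q - f v\<bar> < e" for p q
      using that by (simp add: e_def abs_if field_simps split: if_splits)
    ultimately show False
      using d1(2)[OF h(1,2)] d2(2)[OF h(1,3)] by (metis not_le)
  qed
  with N that show thesis
    by (metis order_le_less)
qed

text \<open>Otherwise \<open>f\<close> would be monotone off a null set, and the pigeonhole
  principle would yield an interval on which it is almost everywhere constant.\<close>

lemma finite_range_second_difference_not_pos:
  fixes f :: "real \<Rightarrow> real"
  assumes int: "\<And>a b. f integrable_on {a..b}"
    and fin: "finite (range f)"
  shows "\<exists>x y. y > 0 \<and> integral {x + y..x + 2 * y} f \<le> integral {x..x + y} f"
proof (rule ccontr)
  assume "\<not> ?thesis"
  then have less: "\<And>x y. y > 0 \<Longrightarrow> integral {x..x + y} f < integral {x + y..x + 2 * y} f"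
    by (meson not_le)
  obtain N where N: "negligible N"
    and mono: "\<And>u v. u \<notin> N \<Longrightarrow> v \<notin> N \<Longrightarrow> u \<le> v \<Longrightarrow> f u \<le> f v"
    using second_difference_pos_imp_AE_mono[OF int less] by blast
  \<comment> \<open>A finite complement would be negligible too, and then so would the whole
    line.\<close>
  have "infinite (- N)"
    using N negligible_Un[OF N negligible_finite[of "- N"]] by auto
  then have "\<not> inj_on f (- N)"
    using finite_imageD[of f "- N"] finite_subset[OF image_mono[OF subset_UNIV] fin] by metis
  then obtain u v where uv: "u \<notin> N" "v \<notin> N" "u < v" "f u = f v"
    using linorder_inj_onI[of "- N" f] by fastforce
  \<comment> \<open>Off \<open>N\<close>, monotonicity squeezes \<open>f\<close> between the equal
    values \<open>f u\<close> and \<open>f v\<close>.\<close>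
  have const: "integral {a..b} f = (b - a) * f u" if "u \<le> a" "a \<le> b" "b \<le> v" for a b
  proof -
    have "integral {a..b} f = integral {a..b} (\<lambda>_. f u)"
    proof (rule integral_spike[OF N])
      fix x assume "x \<in> {a..b} - N"
      with that uv show "f u = f x"
        using mono[of u x] mono[of x v] by auto
    qed
    with that show ?thesis by simp
  qed
  define y where "y = (v - u) / 2"
  have "y > 0" "v = u + 2 * y" using \<open>u < v\<close> by (simp_all add: y_def field_simps)
  with less[of y u] const[of u "u + y"] const[of "u + y" "u + 2 * y"] show False
    by simp
qed

text \<open>A finite range is bounded. Absolute integrability lets Lebesgue integrals be exchanged
  for gauge integrals.\<close>

lemma absolutely_integrable_on_Icc_finite_range:
  fixes f :: "real \<Rightarrow> real"
  assumes "f \<in> borel_measurable lebesgue" and "finite (range f)"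
  shows "f absolutely_integrable_on {a..b}"
proof -
  obtain B where B: "\<And>x. norm (f x) \<le> B"
    using finite_imp_bounded[OF assms(2)] by (auto simp: bounded_iff)
  show ?thesis
  proof (rule measurable_bounded_by_integrable_imp_absolutely_integrable)
    show "f \<in> borel_measurable (lebesgue_on {a..b})"
      using assms(1) by (rule measurable_restrict_space1)
    show "(\<lambda>_. B) integrable_on {a..b}" by (rule integrable_const_ivl)
  qed (use B in auto)
qed

theorem theorem1:
  fixes f :: "real \<Rightarrow> real"
  assumes "f \<in> borel_measurable lebesgue"
    and "finite (range f)"
  shows "\<exists>x y :: real. y > 0 \<and>
    (LINT t:{x..x + y}|lebesgue. f t) = (LINT t:{x + y..x + 2 * y}|lebesgue. f t)"
proof -
  note abs = absolutely_integrable_on_Icc_finite_range[OF assms]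
  have int: "f integrable_on {a..b}" for a b
    using abs by (rule set_lebesgue_integral_eq_integral(1))
  obtain x0 y0 where 0: "y0 > 0" "integral {x0 + y0..x0 + 2 * y0} f \<le> integral {x0..x0 + y0} f"
    using finite_range_second_difference_not_pos[OF int assms(2)] by auto
  \<comment> \<open>Passing to \<open>-f\<close> supplies a point where the second difference has
    the opposite weak sign.\<close>
  have "finite (range (\<lambda>x. - f x))"
    using finite_imageI[OF assms(2), of uminus] by (simp add: image_image)
  then obtain x1 y1 where 1: "y1 > 0"
    "integral {x1..x1 + y1} f \<le> integral {x1 + y1..x1 + 2 * y1} f"
    using finite_range_second_difference_not_pos[of "\<lambda>x. - f x"] int
    by (auto simp: integrable_neg)
  show ?thesis
    using integral_second_difference_vanishes[OF int 0(1) 1(1) 0(2) 1(2)]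
    by (simp add: set_lebesgue_integral_eq_integral(2)[OF abs])
qed

end
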